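(* Let $M$ and $N$ be two weighted means (of the same direction), let $[u,v]\subseteq(0,\infty)$ and let $J\subseteq(0,\infty)$ be an interval. If $f:[u,v]\to J$ is $MN$-convex, then $f$ is bounded.
   Context: A function $M:(0,\infty)\times(0,\infty)\times[0,1]\to(0,\infty)$ is called a weighted mean if the following hold. (WM1) $M(u,v,\lambda)=M(v,u,1-\lambda)$. (WM2) $M(u,u,\lambda)=u$. (WM3) $u<M(u,v,\lambda)<v$ whenever $u<v$ and $\lambda\in(0,1)$. (WM4) $M(\alpha u,\alpha v,\lambda)=\alpha M(u,v,\lambda)$ for all $\alpha>0$. (WM5) For fixed $\lambda\in[0,1]$: $M(u,v,\lambda)\le M(w,v,\lambda)$ whenever $u\le w$, and $M(u,v,\lambda)\le M(u,w,\lambda)$ whenever $v\le w$. (WM6) For fixed $u\ne v$, $M(u,v,\cdot)$ is strictly monotone and continuous on $[0,1]$ with range $[\min\{u,v\},\max\{u,v\}]$. Moreover $M$ has a direction: either $M(u,v,\cdot)$ is strictly increasing for all $u<v$ (positive direction; then $M(u,v,0)=u$, $M(u,v,1)=v$ for all $u,v$), or $M(u,v,\cdot)$ is strictly decreasing for all $u<v$ (negative direction; then $M(u,v,0)=v$, $M(u,v,1)=u$ for all $u,v$). (WM7) $M(M(u,v,\lambda),M(z,w,\lambda),s)=M(M(u,z,s),M(v,w,s),\lambda)$ for all $u,v,z,w>0$, $s,\lambda\in[0,1]$. (WM8) For all $u,v>0$, $s,\lambda_1,\lambda_2\in[0,1]$: $M(M(u,v,\lambda_1),M(u,v,\lambda_2),s)$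 equals $M(u,v,s\lambda_1+(1-s)\lambda_2)$ if $M$ has negative direction, and $M(u,v,(1-s)\lambda_1+s\lambda_2)$ if $M$ has positive direction. Standing assumption: all weighted means occurring together have the same direction. For weighted means $M,N$ and intervals $I,J\subseteq(0,\infty)$, a function $f:I\to J$ is $MN$-convex if $f(M(u,v,\lambda))\le N(f(u),f(v),\lambda)$ for all $u,v\in I$, $\lambda\in[0,1]$. *)

theory Defs
  imports "HOL-Analysis.Analysis"
begin

definition positive_direction :: "(real \<Rightarrow> real \<Rightarrow> real \<Rightarrow> real) \<Rightarrow> bool" where
  "positive_direction M \<longleftrightarrow> (\<forall>u v. 0 < u \<longrightarrow> u < v \<longrightarrow> strict_mono_on {0..1} (M u v))"

definition negative_direction :: "(real \<Rightarrow> real \<Rightarrow> real \<Rightarrow> real) \<Rightarrow> bool" where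
  "negative_direction M \<longleftrightarrow> (\<forall>u v. 0 < u \<longrightarrow> u < v \<longrightarrow> strict_antimono_on {0..1} (M u v))"

text \<open>
  A weighted mean is a function on \<open>(0,\<infinity>) \<times> (0,\<infinity>) \<times> [0,1]\<close>. It is modelled by a total function,
  of which nothing is assumed outside that domain.
\<close>

locale weighted_mean =
  fixes M :: "real \<Rightarrow> real \<Rightarrow> real \<Rightarrow> real"
  assumes pos: "\<lbrakk>0 < u; 0 < v; l \<in> {0..1}\<rbrakk> \<Longrightarrow> 0 < M u v l"
    and WM1: "\<lbrakk>0 < u; 0 < v; l \<in> {0..1}\<rbrakk> \<Longrightarrow> M u v l = M v u (1 - l)"
    and WM2: "\<lbrakk>0 < u; l \<in> {0..1}\<rbrakk> \<Longrightarrow> M u u l = u"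
    and WM3: "\<lbrakk>0 < u; u < v; l \<in> {0<..<1}\<rbrakk> \<Longrightarrow> u < M u v l \<and> M u v l < v"
    and WM4: "\<lbrakk>0 < u; 0 < v; l \<in> {0..1}; 0 < a\<rbrakk> \<Longrightarrow> M (a * u) (a * v) l = a * M u v l"
    and WM5_left: "\<lbrakk>0 < u; 0 < v; l \<in> {0..1}; u \<le> w\<rbrakk> \<Longrightarrow> M u v l \<le> M w v l"
    and WM5_right: "\<lbrakk>0 < u; 0 < v; l \<in> {0..1}; v \<le> w\<rbrakk> \<Longrightarrow> M u v l \<le> M u w l"
    and WM6_monotone: "\<lbrakk>0 < u; 0 < v; u \<noteq> v\<rbrakk> \<Longrightarrow>
        strict_mono_on {0..1} (M u v) \<or> strict_antimono_on {0..1} (M u v)"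
    and WM6_continuous: "\<lbrakk>0 < u; 0 < v; u \<noteq> v\<rbrakk> \<Longrightarrow> continuous_on {0..1} (M u v)"
    and WM6_range: "\<lbrakk>0 < u; 0 < v; u \<noteq> v\<rbrakk> \<Longrightarrow> M u v ` {0..1} = {min u v..max u v}"
    and WM6_direction: "positive_direction M \<or> negative_direction M"
    and WM7: "\<lbrakk>0 < u; 0 < v; 0 < z; 0 < w; s \<in> {0..1}; l \<in> {0..1}\<rbrakk> \<Longrightarrow>
        M (M u v l) (M z w l) s = M (M u z s) (M v w s) l"
    and WM8_negative: "\<lbrakk>negative_direction M; 0 < u; 0 < v; s \<in> {0..1}; l1 \<in> {0..1}; l2 \<in> {0..1}\<rbrakk> \<Longrightarrow>
        M (M u v l1) (M u v l2) s = M u v (s * l1 + (1 - s) * l2)"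
    and WM8_positive: "\<lbrakk>positive_direction M; 0 < u; 0 < v; s \<in> {0..1}; l1 \<in> {0..1}; l2 \<in> {0..1}\<rbrakk> \<Longrightarrow>
        M (M u v l1) (M u v l2) s = M u v ((1 - s) * l1 + s * l2)"

definition same_direction ::
  "(real \<Rightarrow> real \<Rightarrow> real \<Rightarrow> real) \<Rightarrow> (real \<Rightarrow> real \<Rightarrow> real \<Rightarrow> real) \<Rightarrow> bool" where
  "same_direction M N \<longleftrightarrow>
     positive_direction M \<and> positive_direction N \<or> negative_direction M \<and> negative_direction N"

definition MN_convex ::
  "(real \<Rightarrow> real \<Rightarrow> real \<Rightarrow> real) \<Rightarrow> (real \<Rightarrow> real \<Rightarrow> real \<Rightarrow> real) \<Rightarrow> real set \<Rightarrow> real set \<Rightarrow> (real \<Rightarrow> real) \<Rightarrow> bool"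
where
  "MN_convex M N I J f \<longleftrightarrow> f \<in> I \<rightarrow> J \<and>
     (\<forall>u\<in>I. \<forall>v\<in>I. \<forall>l\<in>{0..1}. f (M u v l) \<le> N (f u) (f v) l)"

end

theory Submission
  imports Defs
begin

text \<open>As the weight \<open>l\<close> runs through [0,1], \<open>M u v l\<close> sweeps out the
  whole interval from \<open>u\<close> to \<open>v\<close> (\<open>surj_interval\<close>), so each
  point of it is a mean of the endpoints. Convexity then gives
  \<open>f x \<le> N (f u) (f v) l\<close>, and a mean never exceeds the larger of its arguments
  (\<open>le_max\<close>, used for \<open>N\<close>). Hence \<open>f\<close> is bounded above by its
  larger endpoint value; below, positivity of \<open>J\<close> suffices.\<close>

context weighted_mean
begin

text \<open>Read off from \<open>WM6_range\<close>, which, unlike \<open>WM3\<close>, includes the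
  weights 0 and 1 and either order of the arguments; \<open>f u\<close> and \<open>f v\<close> come
  in no known order.\<close>

lemma le_max:
  assumes "0 < u" "0 < v" "l \<in> {0..1}"
  shows "M u v l \<le> max u v"
proof (cases "u = v")
  case True
  then show ?thesis using assms WM2 by simp
next
  case False
  then have "M u v l \<in> {min u v..max u v}"
    using assms WM6_range by blast
  then show ?thesis by simp
qed

lemma surj_interval:
  assumes "0 < u" "u \<le> v" "x \<in> {u..v}"
  obtains l where "l \<in> {0..1}" "x = M u v l"
proof (cases "u = v")
  case True
  \<comment> \<open>The interval is a single point, which every weight yields; 0 is an arbitrary
    choice.\<close>
  then show ?thesis using assms WM2[of u 0] that[of 0] by simp
next
  case False
  then have "x \<in> M u v ` {0..1}"
    using assms WM6_range[of u v] by simp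
  then show ?thesis using that by blast
qed

end

theorem theorem1:
  fixes M N :: "real \<Rightarrow> real \<Rightarrow> real \<Rightarrow> real" and u v :: real and J :: "real set"
    and f :: "real \<Rightarrow> real"
  assumes "weighted_mean M" and "weighted_mean N" and "same_direction M N"
    and "u \<le> v" and "{u..v} \<subseteq> {0<..}"
    and "is_interval J" and "J \<subseteq> {0<..}"
    and "MN_convex M N {u..v} J f"
  shows "bounded (f ` {u..v})"
proof -
  have endpoints: "u \<in> {u..v}" "v \<in> {u..v}"
    using assms(4) by auto
  have f_pos: "0 < f x" if "x \<in> {u..v}" for x
    using assms(7,8) that unfolding MN_convex_def by (auto simp: Pi_iff)
  have "f x \<le> max (f u) (f v)" if x: "x \<in> {u..v}" for x
  proof -
    have "0 < u" using assms(5) endpoints by auto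
    then obtain l where l: "l \<in> {0..1}" "x = M u v l"
      using weighted_mean.surj_interval[OF assms(1)] assms(4) x by metis
    then have "f x \<le> N (f u) (f v) l"
      using assms(8) endpoints unfolding MN_convex_def by blast
    also have "\<dots> \<le> max (f u) (f v)"
      using weighted_mean.le_max[OF assms(2)] f_pos endpoints l by blast
    finally show ?thesis .
  qed
  \<comment> \<open>The lower bound 0 comes from the codomain, not from convexity.\<close>
  then have "f ` {u..v} \<subseteq> {0..max (f u) (f v)}"
    using f_pos by (fastforce intro: less_imp_le)
  then show ?thesis
    by (rule bounded_subset[OF bounded_closed_interval])
qed

end
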